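(* Assume that $n_1,n_2,n_3$ are even and that $C_h$ and $M_h$ are nodewise local multiplication matrices, and let $A_h(\boldsymbol k)=B_h(\boldsymbol k)C_hB_h(\boldsymbol k)^H$ be as described in the context. Let $\sigma=(\sigma_{12},\sigma_{13})\in\{+1,-1\}^2$, let $Q_\sigma$ be a matrix whose columns form an orthonormal basis of $$\mathcal V_\sigma=\{v\in\mathbb C^{3n}:\ \Gamma_{12}^{(v)}v=\sigma_{12}v,\ \Gamma_{13}^{(v)}v=\sigma_{13}v\},$$ and define $$A_{\sigma,h}(\boldsymbol k)=Q_\sigma^*A_h(\boldsymbol k)Q_\sigma,\qquad M_{\sigma,h}=Q_\sigma^*M_hQ_\sigma.$$ Then the generalized eigenvalue problem $A_h(\boldsymbol k)v=\omega^2M_hv$ restricted to $v\in\mathcal V_\sigma$ is equivalent to $$A_{\sigma,h}(\boldsymbol k)\,y=\omega^2M_{\sigma,h}\,y,\qquad v=Q_\sigma y;$$ that is, for every scalar $\omega^2$ and every vector $y$, the vector $v=Q_\sigma y\in\mathcal V_\sigma$ satisfies $A_h(\boldsymbol k)v=\omega^2M_hv$ if and only if $A_{\sigma,h}(\boldsymbol k)y=\omega^2M_{\sigma,h}y$ (and every $v\in\mathcal V_\sigma$ is of the form $Q_\sigma y$ for a unique $y$).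
   Context: Grid and Bloch shifts. Let $n_1,n_2,n_3$ be positive integers (numbers of grid points in three lattice directions), $n=n_1n_2n_3$, and let $h_1,h_2,h_3>0$ be grid spacings, $h_d=\sqrt{h_1^2+h_2^2+h_3^2}$. Let $\boldsymbol k=(\kappa_1,\kappa_2,\kappa_3)\in\mathbb R^3$ be a reduced Bloch vector and $\phi_\ell=2\pi\kappa_\ell$. Let $A_{\rm lat}=[\boldsymbol a_1,\boldsymbol a_2,\boldsymbol a_3]\in\mathbb R^{3\times3}$ be the invertible matrix of primitive lattice vectors. Vectors in $\mathbb C^n$ are scalar functions $w(i,j,k)$ on the grid $0\le i<n_1$, $0\le j<n_2$, $0\le k<n_3$, ordered with $i$ fastest and $k$ slowest. Define the $n_\ell\times n_\ell$ matrices $$K_\ell=\begin{pmatrix}0&I_{n_\ell-1}\\ e^{\mathrm i\phi_\ell}&0\end{pmatrix},\quad \ell=1,2,3,$$ and $H_1=I_{n_3}\otimes I_{n_2}\otimes K_1$, $H_2=I_{n_3}\otimes K_2\otimes I_{n_1}$, $H_3=K_3\otimes I_{n_2}\otimes I_{n_1}$. Body-diagonal shifts and differences: $S_{d_1}=H_3H_2H_1$, $S_{d_2}=H_3^{-1}H_2H_1$, $S_{d_3}=H_3H_2^{-1}H_1$, $S_{d_4}=H_3^{-1}H_2^{-1}H_1$, and $D_{d_\ell}=(S_{d_\ell}-I)/h_d$ for $\ell=1,2,3,4$. Reconstructed derivatives: $$\widetilde D_1=\tfrac{h_d}{4h_1}(D_{d_1}+D_{d_2}+D_{d_3}+D_{d_4}),\quad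 \widetilde D_2=\tfrac{h_d}{4h_2}(D_{d_1}+D_{d_2}-D_{d_3}-D_{d_4}),\quad \widetilde D_3=\tfrac{h_d}{4h_3}(D_{d_1}-D_{d_2}+D_{d_3}-D_{d_4}),$$ $\widehat{\mathcal D}_s=-\mathrm i\,\widetilde D_s$ for $s=1,2,3$, and $\mathcal D_m=\sum_{s=1}^3(A_{\rm lat}^{-1})_{sm}\widehat{\mathcal D}_s$ for $m=1,2,3$. Discrete divergence matrix ($3n\times 6n$, blocks of size $n\times n$): $$B_h(\boldsymbol k)=\begin{bmatrix}\mathcal D_1&0&0&0&\mathcal D_3&\mathcal D_2\\0&\mathcal D_2&0&\mathcal D_3&0&\mathcal D_1\\0&0&\mathcal D_3&\mathcal D_2&\mathcal D_1&0\end{bmatrix}.$$ The superscripts $H$ and $*$ both denote the conjugate transpose. Material matrices: $C_h\in\mathbb C^{6n\times6n}$ is the discrete stiffness matrix and $M_h\in\mathbb C^{3n\times3n}$ the discrete mass matrix. Vectors in $\mathbb C^{3n}=\mathbb C^3\otimes\mathbb C^n$ and $\mathbb C^{6n}=\mathbb C^6\otimes\mathbb C^n$ are ordered by component first, i.e. they consist of 3 (resp. 6) stacked grid functions. "Nodewise local multiplication matrix" means that the matrix acts independently at each grid node: $C_h$ multiplies the 6 components at each node $x$ by a $6\times6$ matrix depending only on $x$, and $M_h$ multiplies the 3 components at each node $x$ by a $3\times3$ matrix depending only on $x$ (equivalently, every $n\times n$ component block is diagonal). The matrices at different nodes may differ. Parity operators: on $\mathbb C^n$, $(\Gamma_{12}w)(i,j,k)=(-1)^{i+j}w(i,j,k)$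 and $(\Gamma_{13}w)(i,j,k)=(-1)^{i+k}w(i,j,k)$; lifted to $\mathbb C^{3n}$ by $\Gamma_a^{(v)}=I_3\otimes\Gamma_a$, $a\in\{12,13\}$. Orthonormality is with respect to the standard Hermitian inner product. *)

theory Defs
  imports Complex_Main "Jordan_Normal_Form.Schur_Decomposition"
begin

text \<open>Triples such as \<open>(n\<^sub>1, n\<^sub>2, n\<^sub>3)\<close>, \<open>(h\<^sub>1, h\<^sub>2, h\<^sub>3)\<close> and \<open>(\<kappa>\<^sub>1, \<kappa>\<^sub>2, \<kappa>\<^sub>3)\<close> are passed as functions
  on \<open>nat\<close>, of which only the values at 1, 2, 3 matter. Matrices and vectors have the 0-based
  indices of \<^theory>\<open>Jordan_Normal_Form.Matrix\<close>.\<close>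

text \<open>Only meaningful for invertible matrices, on which \<^const>\<open>mat_inverse\<close> is not \<^const>\<open>None\<close>;
  see \<open>mat_inv\<close> below.\<close>

definition mat_inv :: "'a :: field mat \<Rightarrow> 'a mat" where
  "mat_inv A = the (mat_inverse A)"

lemma mat_inv:
  assumes A: "A \<in> carrier_mat m m" and inv: "invertible_mat A"
  shows "A * mat_inv A = 1\<^sub>m m" "mat_inv A * A = 1\<^sub>m m" "mat_inv A \<in> carrier_mat m m"
proof -
  obtain B where B: "A * B = 1\<^sub>m m" "B * A = 1\<^sub>m (dim_row B)"
    using inv A unfolding invertible_mat_def inverts_mat_def by auto
  have "dim_col B = m" using arg_cong[OF B(1), of dim_col] by simp
  moreover have "dim_row B = m" using arg_cong[OF B(2), of dim_col] A by simp
  ultimately have "A \<in> Units (ring_mat TYPE('a) m ())"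
    using A B unfolding Units_def ring_mat_def by (auto intro!: bexI[of _ B])
  then obtain C where "mat_inverse A = Some C"
    using mat_inverse(1)[OF A] by fastforce
  then show "A * mat_inv A = 1\<^sub>m m" "mat_inv A * A = 1\<^sub>m m" "mat_inv A \<in> carrier_mat m m"
    using mat_inverse(2)[OF A] unfolding mat_inv_def by auto
qed

definition kron :: "'a :: times mat \<Rightarrow> 'a mat \<Rightarrow> 'a mat" (infixl "\<otimes>\<^sub>K" 70) where
  "A \<otimes>\<^sub>K B = mat (dim_row A * dim_row B) (dim_col A * dim_col B)
     (\<lambda>(r, c). A $$ (r div dim_row B, c div dim_col B) * B $$ (r mod dim_row B, c mod dim_col B))"

text \<open>The matrix assembled from a rectangular scheme of \<open>m \<times> m\<close> blocks.\<close>

definition of_blocks :: "nat \<Rightarrow> 'a mat list list \<Rightarrow> 'a mat" where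
  "of_blocks m bs = mat (length bs * m) (length (hd bs) * m)
     (\<lambda>(r, c). (bs ! (r div m) ! (c div m)) $$ (r mod m, c mod m))"


subsection \<open>Bloch shifts and the discrete divergence\<close>

definition num_nodes :: "(nat \<Rightarrow> nat) \<Rightarrow> nat" where
  "num_nodes N = N 1 * N 2 * N 3"

definition diag_spacing :: "(nat \<Rightarrow> real) \<Rightarrow> real" where
  "diag_spacing h = sqrt ((h 1)\<^sup>2 + (h 2)\<^sup>2 + (h 3)\<^sup>2)"

definition phase :: "(nat \<Rightarrow> real) \<Rightarrow> nat \<Rightarrow> real" where
  "phase \<kappa> l = 2 * pi * \<kappa> l"

definition K_mat :: "(nat \<Rightarrow> nat) \<Rightarrow> (nat \<Rightarrow> real) \<Rightarrow> nat \<Rightarrow> complex mat" where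
  "K_mat N \<kappa> l = four_block_mat
     (0\<^sub>m (N l - 1) 1)                                  (1\<^sub>m (N l - 1))
     (mat 1 1 (\<lambda>_. exp (\<i> * of_real (phase \<kappa> l))))  (0\<^sub>m 1 (N l - 1))"

definition H1 :: "(nat \<Rightarrow> nat) \<Rightarrow> (nat \<Rightarrow> real) \<Rightarrow> complex mat" where
  "H1 N \<kappa> = 1\<^sub>m (N 3) \<otimes>\<^sub>K 1\<^sub>m (N 2) \<otimes>\<^sub>K K_mat N \<kappa> 1"

definition H2 :: "(nat \<Rightarrow> nat) \<Rightarrow> (nat \<Rightarrow> real) \<Rightarrow> complex mat" where
  "H2 N \<kappa> = 1\<^sub>m (N 3) \<otimes>\<^sub>K K_mat N \<kappa> 2 \<otimes>\<^sub>K 1\<^sub>m (N 1)"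

definition H3 :: "(nat \<Rightarrow> nat) \<Rightarrow> (nat \<Rightarrow> real) \<Rightarrow> complex mat" where
  "H3 N \<kappa> = K_mat N \<kappa> 3 \<otimes>\<^sub>K 1\<^sub>m (N 2) \<otimes>\<^sub>K 1\<^sub>m (N 1)"

definition Sd1 :: "(nat \<Rightarrow> nat) \<Rightarrow> (nat \<Rightarrow> real) \<Rightarrow> complex mat" where
  "Sd1 N \<kappa> = H3 N \<kappa> * H2 N \<kappa> * H1 N \<kappa>"

definition Sd2 :: "(nat \<Rightarrow> nat) \<Rightarrow> (nat \<Rightarrow> real) \<Rightarrow> complex mat" where
  "Sd2 N \<kappa> = mat_inv (H3 N \<kappa>) * H2 N \<kappa> * H1 N \<kappa>"

definition Sd3 :: "(nat \<Rightarrow> nat) \<Rightarrow> (nat \<Rightarrow> real) \<Rightarrow> complex mat" where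
  "Sd3 N \<kappa> = H3 N \<kappa> * mat_inv (H2 N \<kappa>) * H1 N \<kappa>"

definition Sd4 :: "(nat \<Rightarrow> nat) \<Rightarrow> (nat \<Rightarrow> real) \<Rightarrow> complex mat" where
  "Sd4 N \<kappa> = mat_inv (H3 N \<kappa>) * mat_inv (H2 N \<kappa>) * H1 N \<kappa>"

definition diff_of_shift :: "(nat \<Rightarrow> nat) \<Rightarrow> (nat \<Rightarrow> real) \<Rightarrow> complex mat \<Rightarrow> complex mat" where
  "diff_of_shift N h S = of_real (1 / diag_spacing h) \<cdot>\<^sub>m (S - 1\<^sub>m (num_nodes N))"

definition D_tilde ::
  "(nat \<Rightarrow> nat) \<Rightarrow> (nat \<Rightarrow> real) \<Rightarrow> (nat \<Rightarrow> real) \<Rightarrow> nat \<Rightarrow> complex mat" where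
  "D_tilde N \<kappa> h s =
     (let D1 = diff_of_shift N h (Sd1 N \<kappa>);
          D2 = diff_of_shift N h (Sd2 N \<kappa>);
          D3 = diff_of_shift N h (Sd3 N \<kappa>);
          D4 = diff_of_shift N h (Sd4 N \<kappa>)
      in of_real (diag_spacing h / (4 * h s)) \<cdot>\<^sub>m
         (if s = 1 then D1 + D2 + D3 + D4
          else if s = 2 then D1 + D2 - D3 - D4
          else D1 - D2 + D3 - D4))"

definition D_hat ::
  "(nat \<Rightarrow> nat) \<Rightarrow> (nat \<Rightarrow> real) \<Rightarrow> (nat \<Rightarrow> real) \<Rightarrow> nat \<Rightarrow> complex mat" where
  "D_hat N \<kappa> h s = (- \<i>) \<cdot>\<^sub>m D_tilde N \<kappa> h s"

text \<open>The \<open>(s, m)\<close> entry of a matrix, counted from 1, is the \<open>(s - 1, m - 1)\<close> entry below.\<close>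

definition D_cal ::
  "(nat \<Rightarrow> nat) \<Rightarrow> (nat \<Rightarrow> real) \<Rightarrow> (nat \<Rightarrow> real) \<Rightarrow> real mat \<Rightarrow> nat \<Rightarrow> complex mat" where
  "D_cal N \<kappa> h Alat m =
     of_real (mat_inv Alat $$ (0, m - 1)) \<cdot>\<^sub>m D_hat N \<kappa> h 1 +
     of_real (mat_inv Alat $$ (1, m - 1)) \<cdot>\<^sub>m D_hat N \<kappa> h 2 +
     of_real (mat_inv Alat $$ (2, m - 1)) \<cdot>\<^sub>m D_hat N \<kappa> h 3"

definition B_h ::
  "(nat \<Rightarrow> nat) \<Rightarrow> (nat \<Rightarrow> real) \<Rightarrow> (nat \<Rightarrow> real) \<Rightarrow> real mat \<Rightarrow> complex mat" where
  "B_h N \<kappa> h Alat =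
     (let n = num_nodes N; Z = 0\<^sub>m n n;
          D1 = D_cal N \<kappa> h Alat 1; D2 = D_cal N \<kappa> h Alat 2; D3 = D_cal N \<kappa> h Alat 3
      in of_blocks n
          [[D1, Z,  Z,  Z,  D3, D2],
           [Z,  D2, Z,  D3, Z,  D1],
           [Z,  Z,  D3, D2, D1, Z ]])"

definition A_h ::
  "(nat \<Rightarrow> nat) \<Rightarrow> (nat \<Rightarrow> real) \<Rightarrow> (nat \<Rightarrow> real) \<Rightarrow> real mat \<Rightarrow> complex mat \<Rightarrow> complex mat" where
  "A_h N \<kappa> h Alat C = B_h N \<kappa> h Alat * C * mat_adjoint (B_h N \<kappa> h Alat)"


subsection \<open>Nodewise local multiplication\<close>

text \<open>The \<open>p\<close> components at node \<open>x\<close> of a stack \<open>u\<close> of \<open>p\<close> grid functions on \<open>n\<close> nodes.\<close>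

definition at_node :: "nat \<Rightarrow> nat \<Rightarrow> 'a vec \<Rightarrow> nat \<Rightarrow> 'a vec" where
  "at_node p n u x = vec p (\<lambda>a. u $ (a * n + x))"

definition nodewise_local :: "nat \<Rightarrow> nat \<Rightarrow> complex mat \<Rightarrow> bool" where
  "nodewise_local p n A \<longleftrightarrow> A \<in> carrier_mat (p * n) (p * n) \<and>
     (\<exists>L. (\<forall>x<n. L x \<in> carrier_mat p p) \<and>
          (\<forall>u\<in>carrier_vec (p * n). \<forall>x<n. at_node p n (A *\<^sub>v u) x = L x *\<^sub>v at_node p n u x))"


subsection \<open>Parity operators and sectors\<close>

text \<open>As \<open>i\<close> runs fastest and \<open>k\<close> slowest, the node \<open>(i, j, k)\<close> has index
  \<open>i + n\<^sub>1 (j + n\<^sub>2 k)\<close>, which \<open>coord_i\<close>, \<open>coord_j\<close> and \<open>coord_k\<close> invert.\<close>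

definition node_index :: "(nat \<Rightarrow> nat) \<Rightarrow> nat \<Rightarrow> nat \<Rightarrow> nat \<Rightarrow> nat" where
  "node_index N i j k = i + N 1 * (j + N 2 * k)"

definition coord_i :: "(nat \<Rightarrow> nat) \<Rightarrow> nat \<Rightarrow> nat" where
  "coord_i N x = x mod N 1"

definition coord_j :: "(nat \<Rightarrow> nat) \<Rightarrow> nat \<Rightarrow> nat" where
  "coord_j N x = x div N 1 mod N 2"

definition coord_k :: "(nat \<Rightarrow> nat) \<Rightarrow> nat \<Rightarrow> nat" where
  "coord_k N x = x div N 1 div N 2"

definition Gamma12 :: "(nat \<Rightarrow> nat) \<Rightarrow> complex mat" where
  "Gamma12 N = mat_diag (num_nodes N) (\<lambda>x. (- 1) ^ (coord_i N x + coord_j N x))"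

definition Gamma13 :: "(nat \<Rightarrow> nat) \<Rightarrow> complex mat" where
  "Gamma13 N = mat_diag (num_nodes N) (\<lambda>x. (- 1) ^ (coord_i N x + coord_k N x))"

lemma node_index_less:
  assumes "i < N 1" "j < N 2" "k < N 3"
  shows "node_index N i j k < num_nodes N"
proof -
  have "j + N 2 * k < N 2 * Suc k" using assms by simp
  also have "\<dots> \<le> N 2 * N 3" using assms by (intro mult_le_mono2) simp
  finally have "Suc (j + N 2 * k) \<le> N 2 * N 3" by simp
  then have "N 1 * Suc (j + N 2 * k) \<le> N 1 * (N 2 * N 3)" by (rule mult_le_mono2)
  then show ?thesis using assms unfolding node_index_def num_nodes_def by (simp add: mult.assoc)
qed

lemma coord_node_index:
  assumes "i < N 1" "j < N 2"
  shows "coord_i N (node_index N i j k) = i" "coord_j N (node_index N i j k) = j"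
    "coord_k N (node_index N i j k) = k"
  using assms unfolding node_index_def coord_i_def coord_j_def coord_k_def by auto

lemma mat_diag_mult_vec_index:
  fixes w :: "'a :: semiring_1 vec"
  assumes "w \<in> carrier_vec m" "x < m"
  shows "(mat_diag m f *\<^sub>v w) $ x = f x * w $ x"
proof -
  have "(mat_diag m f *\<^sub>v w) $ x = (\<Sum>y\<in>{0..<m}. (if x = y then f y else 0) * w $ y)"
    using assms by (simp add: mat_diag_def scalar_prod_def)
  also have "\<dots> = (\<Sum>y\<in>{0..<m}. if x = y then f y * w $ y else 0)"
    by (rule sum.cong) auto
  finally show ?thesis using assms by simp
qed

lemma Gamma_apply:
  assumes "w \<in> carrier_vec (num_nodes N)" "i < N 1" "j < N 2" "k < N 3"
  shows "(Gamma12 N *\<^sub>v w) $ node_index N i j k = (- 1) ^ (i + j) * w $ node_index N i j k"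
    and "(Gamma13 N *\<^sub>v w) $ node_index N i j k = (- 1) ^ (i + k) * w $ node_index N i j k"
  using assms
  by (simp_all add: Gamma12_def Gamma13_def mat_diag_mult_vec_index node_index_less coord_node_index)

definition parity_sector :: "(nat \<Rightarrow> nat) \<Rightarrow> complex \<Rightarrow> complex \<Rightarrow> complex vec set" where
  "parity_sector N \<sigma>12 \<sigma>13 = {v \<in> carrier_vec (3 * num_nodes N).
     (1\<^sub>m 3 \<otimes>\<^sub>K Gamma12 N) *\<^sub>v v = \<sigma>12 \<cdot>\<^sub>v v \<and> (1\<^sub>m 3 \<otimes>\<^sub>K Gamma13 N) *\<^sub>v v = \<sigma>13 \<cdot>\<^sub>v v}"

text \<open>The columns of \<open>Q\<close> form an orthonormal basis of the subspace \<open>V\<close> of \<open>\<complex>\<^sup>m\<close>; linear independence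
  is a consequence of orthonormality.\<close>

definition orthonormal_basis_cols :: "nat \<Rightarrow> complex mat \<Rightarrow> complex vec set \<Rightarrow> bool" where
  "orthonormal_basis_cols m Q V \<longleftrightarrow> dim_row Q = m \<and>
     (\<forall>a<dim_col Q. \<forall>b<dim_col Q. col Q a \<bullet>c col Q b = (if a = b then 1 else 0)) \<and>
     LinearCombinations.module.span class_ring (module_vec TYPE(complex) m) (set (cols Q)) = V"

end

theory Submission
  imports Defs
begin

text \<open>The sector is an invariant subspace of both \<open>A\<^sub>h\<close> and \<open>M\<^sub>h\<close>, and on an invariant subspace
  compression by an orthonormal basis loses nothing.

  Invariance: a single shift \<open>H\<^sub>l\<close> changes one grid coordinate by one. As \<open>n\<^sub>l\<close> is even, this
  flips the parity of that coordinate even where the shift wraps around, so \<open>H\<^sub>l\<close> commutes or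
  anticommutes with each of \<open>\<Gamma>\<^sub>1\<^sub>2\<close> and \<open>\<Gamma>\<^sub>1\<^sub>3\<close>, and so does its inverse. A body-diagonal shift changes
  all three coordinates at once, and each of \<open>\<Gamma>\<^sub>1\<^sub>2\<close> and \<open>\<Gamma>\<^sub>1\<^sub>3\<close> sees exactly two of them: the two
  signs cancel, and the reconstructed derivatives commute with both operators
  (\<open>sign_preserving_D_cal\<close>). Hence so does every block of \<open>B\<^sub>h\<close>. A nodewise local matrix couples
  only components at the same node, where the lifted parity operators act by one common sign, so it
  commutes with them too (\<open>sign_twisted_nodewise_local\<close>). Commuting operators preserve the joint
  eigenspace that defines the sector.

  All these operators are products, sums, adjoints, Kronecker products or block arrangements of very
  sparse matrices, and commutation up to a sign with a diagonal matrix is a condition on the sparsity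
  pattern only. The condition \<open>sign_twisted\<close> expresses it entry by entry and is
  closed under all these operations.

  Compression: as \<open>Q\<^sup>* Q = I\<close> and \<open>V\<close> is the range of \<open>Q\<close>, the map \<open>Q\<^sup>*\<close> is injective on \<open>V\<close>. Both
  sides of the eigenvalue equation at \<open>v = Q y\<close> lie in \<open>V\<close>, so they agree if and only if their
  images under \<open>Q\<^sup>*\<close> do (\<open>galerkin_equivalence\<close>).\<close>

section \<open>Unitarity\<close>

lemma mat_adjoint_dim [simp]:
  "dim_row (mat_adjoint X) = dim_col X" "dim_col (mat_adjoint X) = dim_row X"
  unfolding mat_adjoint_def by simp_all

lemma mat_adjoint_index:
  fixes X :: "complex mat"
  assumes "r < dim_col X" "c < dim_row X"
  shows "mat_adjoint X $$ (r, c) = cnj (X $$ (c, r))"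
  using assms unfolding mat_adjoint_def by (simp add: mat_of_rows_def)

definition unitary :: "nat \<Rightarrow> complex mat \<Rightarrow> bool" where
  "unitary m U \<longleftrightarrow> U \<in> carrier_mat m m \<and> U * mat_adjoint U = 1\<^sub>m m"

text \<open>The inverse shifts become adjoints, to which sign rules transfer entry by entry.\<close>

lemma mat_inv_unitary:
  assumes "unitary m U"
  shows "mat_inv U = mat_adjoint U"
proof -
  have U: "U \<in> carrier_mat m m" and UU: "U * mat_adjoint U = 1\<^sub>m m"
    using assms by (auto simp: unitary_def)
  have U': "mat_adjoint U \<in> carrier_mat m m" using U by (intro carrier_matI) auto
  have "invertible_mat U"
    unfolding invertible_mat_def inverts_mat_def
    using U U' UU mat_mult_left_right_inverse[OF U U' UU] by auto
  note inv = mat_inv[OF U this]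
  have "mat_inv U = mat_inv U * (U * mat_adjoint U)" using inv(3) by (simp add: UU)
  also have "\<dots> = mat_inv U * U * mat_adjoint U" using inv(3) U U' by simp
  finally show ?thesis using left_mult_one_mat[OF U'] by (simp add: inv(2))
qed

lemma unitary_one: "unitary m (1\<^sub>m m)"
  unfolding unitary_def by (auto intro!: eq_matI simp: mat_adjoint_index)

text \<open>The pair \<open>(t div n, t mod n)\<close> runs through \<open>{0..<m} \<times> {0..<n}\<close>.\<close>

lemma sum_div_mod:
  fixes F G :: "nat \<Rightarrow> 'a :: comm_semiring_0"
  shows "(\<Sum>t = 0..<m * n. F (t div n) * G (t mod n)) = (\<Sum>a = 0..<m. F a) * (\<Sum>b = 0..<n. G b)"
proof (induction m)
  case (Suc m)
  have "(\<Sum>t = m * n..<m * n + n. F (t div n) * G (t mod n)) =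
      (\<Sum>b = 0..<n. F ((b + m * n) div n) * G ((b + m * n) mod n))"
    using sum.shift_bounds_nat_ivl[of "\<lambda>t. F (t div n) * G (t mod n)" 0 "m * n" n]
    by (simp add: add.commute)
  also have "\<dots> = (\<Sum>b = 0..<n. F m * G b)" by (rule sum.cong) auto
  finally have block: "(\<Sum>t = m * n..<m * n + n. F (t div n) * G (t mod n)) = F m * (\<Sum>b = 0..<n. G b)"
    by (simp add: sum_distrib_left)
  have "(\<Sum>t = 0..<Suc m * n. F (t div n) * G (t mod n)) =
      (\<Sum>t = 0..<m * n. F (t div n) * G (t mod n)) + (\<Sum>t = m * n..<m * n + n. F (t div n) * G (t mod n))"
    by (simp add: add.commute sum.atLeastLessThan_concat)
  then show ?case using Suc block by (simp add: algebra_simps)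
qed simp

lemma kron_carrier:
  assumes "X \<in> carrier_mat m m" "Y \<in> carrier_mat n n"
  shows "X \<otimes>\<^sub>K Y \<in> carrier_mat (m * n) (m * n)"
  using assms unfolding kron_def by auto

lemma kron_index:
  assumes "X \<in> carrier_mat m m" "Y \<in> carrier_mat n n" "r < m * n" "c < m * n"
  shows "(X \<otimes>\<^sub>K Y) $$ (r, c) = X $$ (r div n, c div n) * Y $$ (r mod n, c mod n)"
  using assms unfolding kron_def by auto

lemma div_mod_less:
  fixes r :: nat
  assumes "r < m * n"
  shows "r div n < m" "r mod n < n"
proof -
  have "n > 0" using assms by (cases n) auto
  then show "r div n < m" "r mod n < n" using assms by (auto simp: less_mult_imp_div_less)
qed

lemma unitary_rowsI:
  assumes "U \<in> carrier_mat m m"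
    and "\<And>r c. r < m \<Longrightarrow> c < m \<Longrightarrow>
      (\<Sum>t = 0..<m. U $$ (r, t) * cnj (U $$ (c, t))) = (if r = c then 1 else 0)"
  shows "unitary m U"
  unfolding unitary_def
  using assms by (auto intro!: eq_matI simp: scalar_prod_def mat_adjoint_index)

lemma unitary_rowsD:
  assumes "unitary m U" "r < m" "c < m"
  shows "(\<Sum>t = 0..<m. U $$ (r, t) * cnj (U $$ (c, t))) = (if r = c then 1 else 0)"
proof -
  have U: "U \<in> carrier_mat m m" and UU: "U * mat_adjoint U = 1\<^sub>m m"
    using assms by (auto simp: unitary_def)
  have "(U * mat_adjoint U) $$ (r, c) = (\<Sum>t = 0..<m. U $$ (r, t) * cnj (U $$ (c, t)))"
    using U assms by (simp add: scalar_prod_def mat_adjoint_index)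
  then show ?thesis using UU assms by simp
qed

text \<open>The inner product of two rows of a Kronecker product is the product of the inner products of the
  corresponding rows of the factors.\<close>

lemma unitary_kron:
  assumes X: "unitary m X" and Y: "unitary n Y"
  shows "unitary (m * n) (X \<otimes>\<^sub>K Y)"
proof (rule unitary_rowsI)
  have XY: "X \<in> carrier_mat m m" "Y \<in> carrier_mat n n" using X Y by (auto simp: unitary_def)
  then show "X \<otimes>\<^sub>K Y \<in> carrier_mat (m * n) (m * n)" by (rule kron_carrier)
  fix r c assume rc: "r < m * n" "c < m * n"
  let ?x = "\<lambda>t. X $$ (r div n, t) * cnj (X $$ (c div n, t))"
  let ?y = "\<lambda>t. Y $$ (r mod n, t) * cnj (Y $$ (c mod n, t))"
  have "(\<Sum>t = 0..<m * n. (X \<otimes>\<^sub>K Y) $$ (r, t) * cnj ((X \<otimes>\<^sub>K Y) $$ (c, t))) =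
      (\<Sum>t = 0..<m * n. ?x (t div n) * ?y (t mod n))"
    using rc by (intro sum.cong) (auto simp: kron_index[OF XY])
  also have "\<dots> = (\<Sum>t = 0..<m. ?x t) * (\<Sum>t = 0..<n. ?y t)" by (rule sum_div_mod)
  also have "\<dots> = (if r div n = c div n then 1 else 0) * (if r mod n = c mod n then 1 else 0)"
    using unitary_rowsD[OF X] unitary_rowsD[OF Y] div_mod_less rc by simp
  also have "\<dots> = (if r = c then 1 else 0)" by (auto, metis div_mult_mod_eq)
  finally show "(\<Sum>t = 0..<m * n. (X \<otimes>\<^sub>K Y) $$ (r, t) * cnj ((X \<otimes>\<^sub>K Y) $$ (c, t))) =
      (if r = c then 1 else 0)" .
qed

lemma K_mat_carrier:
  assumes "N l > 0"
  shows "K_mat N \<kappa> l \<in> carrier_mat (N l) (N l)"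
  using assms unfolding K_mat_def by auto

text \<open>The cyclic form of the shift treats the row that carries the Bloch phase like every other row. It
  is also correct for \<open>N l = 1\<close>, where the phase is the only entry.\<close>

lemma K_mat_index:
  assumes "r < N l" "c < N l"
  shows "K_mat N \<kappa> l $$ (r, c) = (if c = Suc r mod N l
     then (if Suc r = N l then exp (\<i> * of_real (phase \<kappa> l)) else 1) else 0)"
proof (cases "Suc r = N l")
  case True
  then show ?thesis using assms unfolding K_mat_def by auto
next
  case False
  then show ?thesis using assms unfolding K_mat_def by auto
qed

lemma Suc_mod_inj:
  assumes "r < n" "c < n" "Suc r mod n = Suc c mod n"
  shows "r = c"
  using assms by (auto simp: mod_Suc split: if_splits)

text \<open>Each row has one nonzero entry, of modulus one, and no two rows have it in the same column.\<close>

lemma unitary_K_mat: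
  assumes "N l > 0"
  shows "unitary (N l) (K_mat N \<kappa> l)"
proof (rule unitary_rowsI)
  show "K_mat N \<kappa> l \<in> carrier_mat (N l) (N l)" using assms by (rule K_mat_carrier)
  fix r c assume rc: "r < N l" "c < N l"
  let ?K = "K_mat N \<kappa> l" and ?e = "exp (\<i> * of_real (phase \<kappa> l))"
  have e: "?e * cnj ?e = 1" by (simp flip: complex_norm_square)
  have "(\<Sum>t = 0..<N l. ?K $$ (r, t) * cnj (?K $$ (c, t))) =
      (\<Sum>t = 0..<N l. if t = Suc r mod N l then ?K $$ (r, t) * cnj (?K $$ (c, t)) else 0)"
    using rc by (intro sum.cong) (auto simp: K_mat_index)
  also have "\<dots> = ?K $$ (r, Suc r mod N l) * cnj (?K $$ (c, Suc r mod N l))"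
    using assms by simp
  also have "\<dots> = (if r = c then 1 else 0)"
    using rc assms e Suc_mod_inj[of r "N l" c] by (auto simp: K_mat_index)
  finally show "(\<Sum>t = 0..<N l. ?K $$ (r, t) * cnj (?K $$ (c, t))) = (if r = c then 1 else 0)" .
qed

lemma unitary_H:
  assumes "N 1 > 0" "N 2 > 0" "N 3 > 0"
  shows "unitary (num_nodes N) (H1 N \<kappa>)" "unitary (num_nodes N) (H2 N \<kappa>)"
    "unitary (num_nodes N) (H3 N \<kappa>)"
proof -
  have n: "num_nodes N = N 3 * N 2 * N 1" by (simp add: num_nodes_def)
  show "unitary (num_nodes N) (H1 N \<kappa>)" "unitary (num_nodes N) (H2 N \<kappa>)"
    "unitary (num_nodes N) (H3 N \<kappa>)"
    unfolding n H1_def H2_def H3_def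
    using assms by (intro unitary_kron unitary_one unitary_K_mat; simp)+
qed

section \<open>Matrices that commute with a diagonal sign operator up to a sign\<close>

text \<open>Multiplying out the diagonal matrices shows that this says \<open>diag(g) X = s X diag(g)\<close>. The one
  function \<open>g\<close> serves the rows and the columns of rectangular matrices as well, since it is not
  tied to a size.\<close>

definition sign_twisted :: "complex \<Rightarrow> (nat \<Rightarrow> complex) \<Rightarrow> complex mat \<Rightarrow> bool" where
  "sign_twisted s g X \<longleftrightarrow>
     (\<forall>r<dim_row X. \<forall>c<dim_col X. X $$ (r, c) \<noteq> 0 \<longrightarrow> g r = s * g c)"

lemma sign_twisted_one: "sign_twisted 1 g (1\<^sub>m n)"
  unfolding sign_twisted_def by auto

lemma sign_twisted_zero: "sign_twisted s g (0\<^sub>m m n)"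
  unfolding sign_twisted_def by auto

lemma sign_twisted_smult: "sign_twisted s g X \<Longrightarrow> sign_twisted s g (a \<cdot>\<^sub>m X)"
  unfolding sign_twisted_def by auto

lemma sign_twisted_add:
  assumes "X \<in> carrier_mat m n" "Y \<in> carrier_mat m n" "sign_twisted s g X" "sign_twisted s g Y"
  shows "sign_twisted s g (X + Y)"
  using assms unfolding sign_twisted_def by fastforce

lemma sign_twisted_minus:
  assumes "X \<in> carrier_mat m n" "Y \<in> carrier_mat m n" "sign_twisted s g X" "sign_twisted s g Y"
  shows "sign_twisted s g (X - Y)"
  using assms unfolding sign_twisted_def by fastforce

lemma sign_twisted_mult:
  assumes X: "X \<in> carrier_mat l m" "sign_twisted s g X"
    and Y: "Y \<in> carrier_mat m n" "sign_twisted t g Y"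
  shows "sign_twisted (s * t) g (X * Y)"
  unfolding sign_twisted_def
proof (intro allI impI)
  fix r c assume rc: "r < dim_row (X * Y)" "c < dim_col (X * Y)" "(X * Y) $$ (r, c) \<noteq> 0"
  then have "(\<Sum>k = 0..<m. X $$ (r, k) * Y $$ (k, c)) \<noteq> 0"
    using X Y by (simp add: scalar_prod_def)
  then obtain k where "k < m" "X $$ (r, k) \<noteq> 0" "Y $$ (k, c) \<noteq> 0"
    by (auto elim!: sum.not_neutral_contains_not_neutral)
  then show "g r = s * t * g c" using X Y rc unfolding sign_twisted_def by force
qed

text \<open>The condition \<open>g r = s * g c\<close> must be solved for \<open>g c\<close>, which keeps the sign only if \<open>s\<close> is its
  own inverse.\<close>

lemma sign_twisted_adjoint:
  assumes "sign_twisted s g X" "s * s = 1"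
  shows "sign_twisted s g (mat_adjoint X)"
  unfolding sign_twisted_def
proof (intro allI impI)
  fix r c assume rc: "r < dim_row (mat_adjoint X)" "c < dim_col (mat_adjoint X)"
    "mat_adjoint X $$ (r, c) \<noteq> 0"
  then have "X $$ (c, r) \<noteq> 0" by (simp add: mat_adjoint_index)
  then have "g c = s * g r" using assms rc unfolding sign_twisted_def by simp
  then show "g r = s * g c" using assms(2) by (simp flip: mult.assoc)
qed

lemma sign_twisted_mat_inv:
  assumes "unitary m U" "sign_twisted s g U" "s * s = 1"
  shows "sign_twisted s g (mat_inv U)"
  using assms by (simp add: mat_inv_unitary sign_twisted_adjoint)

lemma sign_twisted_kron:
  assumes X: "X \<in> carrier_mat m m" "sign_twisted s g X"
    and Y: "Y \<in> carrier_mat n n" "sign_twisted t h Y"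
  shows "sign_twisted (s * t) (\<lambda>x. g (x div n) * h (x mod n)) (X \<otimes>\<^sub>K Y)"
  unfolding sign_twisted_def
proof (intro allI impI)
  fix r c assume "r < dim_row (X \<otimes>\<^sub>K Y)" "c < dim_col (X \<otimes>\<^sub>K Y)" and nz: "(X \<otimes>\<^sub>K Y) $$ (r, c) \<noteq> 0"
  then have rc: "r < m * n" "c < m * n" using kron_carrier[OF X(1) Y(1)] by auto
  then have "X $$ (r div n, c div n) \<noteq> 0" "Y $$ (r mod n, c mod n) \<noteq> 0"
    using nz by (auto simp: kron_index[OF X(1) Y(1)])
  then have "g (r div n) = s * g (c div n)" "h (r mod n) = t * h (c mod n)"
    using X Y div_mod_less[OF rc(1)] div_mod_less[OF rc(2)] unfolding sign_twisted_def by auto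
  then show "g (r div n) * h (r mod n) = s * t * (g (c div n) * h (c mod n))" by simp
qed

text \<open>Stacking the same sign function on every component is compatible with any block arrangement, as
  \<open>r mod n\<close> is the position inside a block.\<close>

lemma sign_twisted_of_blocks:
  assumes len: "\<And>row. row \<in> set bs \<Longrightarrow> length row = length (hd bs)"
    and blocks: "\<And>row X. row \<in> set bs \<Longrightarrow> X \<in> set row \<Longrightarrow> X \<in> carrier_mat n n \<and> sign_twisted s g X"
  shows "sign_twisted s (\<lambda>x. g (x mod n)) (of_blocks n bs)"
  unfolding sign_twisted_def
proof (intro allI impI)
  fix r c assume "r < dim_row (of_blocks n bs)" "c < dim_col (of_blocks n bs)"
    and nz: "of_blocks n bs $$ (r, c) \<noteq> 0"
  then have rc: "r < length bs * n" "c < length (hd bs) * n" by (auto simp: of_blocks_def)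
  note d = div_mod_less[OF rc(1)] div_mod_less[OF rc(2)]
  have row: "bs ! (r div n) \<in> set bs" using d by simp
  then have X: "bs ! (r div n) ! (c div n) \<in> carrier_mat n n"
    "sign_twisted s g (bs ! (r div n) ! (c div n))"
    using blocks[OF row nth_mem] len[OF row] d by auto
  have "(bs ! (r div n) ! (c div n)) $$ (r mod n, c mod n) \<noteq> 0"
    using nz rc by (simp add: of_blocks_def)
  then show "g (r mod n) = s * g (c mod n)"
    using X d unfolding sign_twisted_def by auto
qed

text \<open>The column of \<open>X\<close> at \<open>c\<close> is the image of a unit vector, which vanishes at every node other
  than \<open>c mod n\<close>; locality makes its image vanish there too. So all nonzero entries of \<open>X\<close>
  couple equal nodes, and any function of the node is preserved.\<close>

lemma sign_twisted_nodewise_local: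
  assumes "nodewise_local p n X"
  shows "sign_twisted 1 (\<lambda>x. g (x mod n)) X"
  unfolding sign_twisted_def
proof (intro allI impI)
  obtain L where X: "X \<in> carrier_mat (p * n) (p * n)" and Lc: "\<And>x. x < n \<Longrightarrow> L x \<in> carrier_mat p p"
    and L: "\<And>u x. u \<in> carrier_vec (p * n) \<Longrightarrow> x < n \<Longrightarrow>
      at_node p n (X *\<^sub>v u) x = L x *\<^sub>v at_node p n u x"
    using assms unfolding nodewise_local_def by blast
  fix r c assume "r < dim_row X" "c < dim_col X" and nz: "X $$ (r, c) \<noteq> 0"
  then have rc: "r < p * n" "c < p * n" using X by auto
  note d = div_mod_less[OF rc(1)] div_mod_less[OF rc(2)]
  let ?u = "unit_vec (p * n) c :: complex vec"
  have "r mod n = c mod n"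
  proof (rule ccontr)
    assume ne: "r mod n \<noteq> c mod n"
    have less: "a * n + r mod n < p * n" if "a < p" for a
    proof -
      have "a * n + r mod n < Suc a * n" using d by simp
      also have "\<dots> \<le> p * n" using that by (intro mult_le_mono1) simp
      finally show ?thesis .
    qed
    have "at_node p n ?u (r mod n) = 0\<^sub>v p"
      using ne less by (intro eq_vecI) (auto simp: at_node_def unit_vec_def)
    then have "at_node p n (X *\<^sub>v ?u) (r mod n) = 0\<^sub>v p"
      using L[of ?u "r mod n"] Lc[of "r mod n"] d by (auto intro!: eq_vecI)
    then have "at_node p n (X *\<^sub>v ?u) (r mod n) $ (r div n) = 0" using d by simp
    then have "X $$ (r, c) = 0" using d rc X by (simp add: at_node_def)
    then show False using nz by simp
  qed
  then show "g (r mod n) = 1 * g (c mod n)" by simp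
qed

section \<open>Parity of the shifts\<close>

abbreviation alternating :: "nat \<Rightarrow> complex" where
  "alternating x \<equiv> (- 1) ^ x"

text \<open>Evenness of \<open>N l\<close> is what makes the wrap-around entry, from the odd coordinate \<open>N l - 1\<close> to
  \<open>0\<close>, flip the parity like all the others.\<close>

lemma sign_twisted_K_mat:
  assumes "N l > 0" "even (N l)"
  shows "sign_twisted (- 1) alternating (K_mat N \<kappa> l)"
  unfolding sign_twisted_def
proof (intro allI impI)
  fix r c assume "r < dim_row (K_mat N \<kappa> l)" "c < dim_col (K_mat N \<kappa> l)"
    and "K_mat N \<kappa> l $$ (r, c) \<noteq> 0"
  then have "c = Suc r mod N l"
    using K_mat_carrier[of N l \<kappa>, OF assms(1)] by (auto simp: K_mat_index split: if_splits)
  then have "even c \<longleftrightarrow> odd r" using assms(2) by (simp add: dvd_mod_iff)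
  then show "alternating r = - 1 * alternating c" by (auto simp: minus_one_power_iff)
qed

lemma sign_twisted_constant: "sign_twisted 1 (\<lambda>_. 1) X"
  unfolding sign_twisted_def by simp

text \<open>Both parity operators have this product form, with \<open>alternating\<close> for the two coordinates that
  they see and the constant 1 for the third.\<close>

definition node_sign ::
  "(nat \<Rightarrow> nat) \<Rightarrow> (nat \<Rightarrow> complex) \<Rightarrow> (nat \<Rightarrow> complex) \<Rightarrow> (nat \<Rightarrow> complex) \<Rightarrow> nat \<Rightarrow> complex" where
  "node_sign N a b c x = a (coord_i N x) * b (coord_j N x) * c (coord_k N x)"

text \<open>The first Kronecker factor acts on the slowest coordinate, hence the reversed order.\<close>

lemma sign_twisted_kron3:
  assumes "X \<in> carrier_mat (N 3) (N 3)" "sign_twisted s c X"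
    and "Y \<in> carrier_mat (N 2) (N 2)" "sign_twisted t b Y"
    and "Z \<in> carrier_mat (N 1) (N 1)" "sign_twisted u a Z"
  shows "sign_twisted (s * t * u) (node_sign N a b c) (X \<otimes>\<^sub>K Y \<otimes>\<^sub>K Z)"
proof -
  have "node_sign N a b c = (\<lambda>x. c (x div N 1 div N 2) * b (x div N 1 mod N 2) * a (x mod N 1))"
    by (rule ext) (simp add: node_sign_def coord_i_def coord_j_def coord_k_def)
  then show ?thesis
    using sign_twisted_kron[OF kron_carrier[OF assms(1,3)] sign_twisted_kron[OF assms(1-4)] assms(5,6)]
    by simp
qed

lemma sign_twisted_H:
  assumes N: "N 1 > 0" "N 2 > 0" "N 3 > 0"
    and K: "sign_twisted s a (K_mat N \<kappa> 1)" "sign_twisted t b (K_mat N \<kappa> 2)"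
      "sign_twisted u c (K_mat N \<kappa> 3)"
  shows "sign_twisted s (node_sign N a b c) (H1 N \<kappa>)"
    "sign_twisted t (node_sign N a b c) (H2 N \<kappa>)"
    "sign_twisted u (node_sign N a b c) (H3 N \<kappa>)"
proof -
  note K' = K_mat_carrier[of N 1 \<kappa>, OF N(1)] K_mat_carrier[of N 2 \<kappa>, OF N(2)]
    K_mat_carrier[of N 3 \<kappa>, OF N(3)]
  note I1 = one_carrier_mat[of "N 1"] sign_twisted_one[of a "N 1"]
    and I2 = one_carrier_mat[of "N 2"] sign_twisted_one[of b "N 2"]
    and I3 = one_carrier_mat[of "N 3"] sign_twisted_one[of c "N 3"]
  show "sign_twisted s (node_sign N a b c) (H1 N \<kappa>)"
    using sign_twisted_kron3[where N = N, OF I3 I2 K'(1) K(1)] by (simp add: H1_def)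
  show "sign_twisted t (node_sign N a b c) (H2 N \<kappa>)"
    using sign_twisted_kron3[where N = N, OF I3 K'(2) K(2) I1] by (simp add: H2_def)
  show "sign_twisted u (node_sign N a b c) (H3 N \<kappa>)"
    using sign_twisted_kron3[where N = N, OF K'(3) K(3) I2 I1] by (simp add: H3_def)
qed

text \<open>The sums and differences below need matching dimensions, so these are bundled with the sign rule.\<close>

definition sign_preserving :: "nat \<Rightarrow> (nat \<Rightarrow> complex) \<Rightarrow> complex mat \<Rightarrow> bool" where
  "sign_preserving n g X \<longleftrightarrow> X \<in> carrier_mat n n \<and> sign_twisted 1 g X"

text \<open>Every body-diagonal shift is \<open>H\<^sub>3\<^sup>\<plusminus>\<close> \<open>H\<^sub>2\<^sup>\<plusminus>\<close> \<open>H\<^sub>1\<close>, and inversion does not change a sign rule, so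
  all four shifts have the sign \<open>u * t * s\<close>. The derivatives are linear combinations of them and
  the identity.\<close>

lemma sign_preserving_D_cal:
  assumes U: "unitary (num_nodes N) (H1 N \<kappa>)" "unitary (num_nodes N) (H2 N \<kappa>)"
      "unitary (num_nodes N) (H3 N \<kappa>)"
    and H: "sign_twisted s g (H1 N \<kappa>)" "sign_twisted t g (H2 N \<kappa>)" "sign_twisted u g (H3 N \<kappa>)"
    and tu: "t * t = 1" "u * u = 1" "u * t * s = 1"
  shows "sign_preserving (num_nodes N) g (D_cal N \<kappa> h Alat m)"
proof -
  let ?n = "num_nodes N"
  have add: "sign_preserving ?n g (X + Y)" and minus: "sign_preserving ?n g (X - Y)"
    if "sign_preserving ?n g X" "sign_preserving ?n g Y" for X Y
    using that sign_twisted_add sign_twisted_minus unfolding sign_preserving_def by auto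
  have smult: "sign_preserving ?n g (a \<cdot>\<^sub>m X)" if "sign_preserving ?n g X" for a X
    using that sign_twisted_smult unfolding sign_preserving_def by auto
  have one: "sign_preserving ?n g (1\<^sub>m ?n)"
    using sign_twisted_one unfolding sign_preserving_def by auto
  have carrier: "H1 N \<kappa> \<in> carrier_mat ?n ?n" "H2 N \<kappa> \<in> carrier_mat ?n ?n" "H3 N \<kappa> \<in> carrier_mat ?n ?n"
    using U unfolding unitary_def by auto
  have carrier': "mat_inv (H2 N \<kappa>) \<in> carrier_mat ?n ?n" "mat_inv (H3 N \<kappa>) \<in> carrier_mat ?n ?n"
    using carrier U by (auto simp: mat_inv_unitary intro!: carrier_matI)
  have H': "sign_twisted t g (mat_inv (H2 N \<kappa>))" "sign_twisted u g (mat_inv (H3 N \<kappa>))"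
    using sign_twisted_mat_inv[OF U(2) H(2) tu(1)] sign_twisted_mat_inv[OF U(3) H(3) tu(2)] .
  have prod: "sign_preserving ?n g (X * Y * Z)"
    if "X \<in> carrier_mat ?n ?n" "sign_twisted u g X" "Y \<in> carrier_mat ?n ?n" "sign_twisted t g Y"
      "Z \<in> carrier_mat ?n ?n" "sign_twisted s g Z" for X Y Z
    using sign_twisted_mult[OF mult_carrier_mat[OF that(1,3)] sign_twisted_mult[OF that(1-4)] that(5,6)]
      that tu(3) unfolding sign_preserving_def by auto
  have S: "sign_preserving ?n g (Sd1 N \<kappa>)" "sign_preserving ?n g (Sd2 N \<kappa>)"
      "sign_preserving ?n g (Sd3 N \<kappa>)" "sign_preserving ?n g (Sd4 N \<kappa>)"
    unfolding Sd1_def Sd2_def Sd3_def Sd4_def by (intro prod carrier carrier' H H')+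
  show ?thesis
    unfolding D_cal_def D_hat_def D_tilde_def diff_of_shift_def Let_def
    by (intro add smult) (auto intro!: add minus smult one S)
qed

lemma sign_twisted_A_h:
  assumes D: "\<And>m. sign_preserving (num_nodes N) g (D_cal N \<kappa> h Alat m)"
    and C: "nodewise_local 6 (num_nodes N) C"
  shows "sign_twisted 1 (\<lambda>x. g (x mod num_nodes N)) (A_h N \<kappa> h Alat C)"
    "A_h N \<kappa> h Alat C \<in> carrier_mat (3 * num_nodes N) (3 * num_nodes N)"
proof -
  let ?n = "num_nodes N" and ?B = "B_h N \<kappa> h Alat"
  let ?g = "\<lambda>x. g (x mod ?n)"
  have B: "?B \<in> carrier_mat (3 * ?n) (6 * ?n)"
    unfolding B_h_def of_blocks_def Let_def by (rule carrier_matI) simp_all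
  have D1: "D_cal N \<kappa> h Alat m \<in> carrier_mat ?n ?n" "sign_twisted 1 g (D_cal N \<kappa> h Alat m)" for m
    using D[of m] unfolding sign_preserving_def by auto
  have tB: "sign_twisted 1 ?g ?B"
    unfolding B_h_def Let_def
    by (rule sign_twisted_of_blocks) (auto simp: D1 sign_twisted_zero)
  have C1: "C \<in> carrier_mat (6 * ?n) (6 * ?n)" using C unfolding nodewise_local_def by auto
  have B': "mat_adjoint ?B \<in> carrier_mat (6 * ?n) (3 * ?n)" using B by (intro carrier_matI) auto
  show "A_h N \<kappa> h Alat C \<in> carrier_mat (3 * ?n) (3 * ?n)"
    unfolding A_h_def using B B' C1 by auto
  have "sign_twisted (1 * 1 * 1) ?g (?B * C * mat_adjoint ?B)"
    by (intro sign_twisted_mult[OF mult_carrier_mat[OF B C1] _ B']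
        sign_twisted_mult[OF B tB C1] sign_twisted_nodewise_local[OF C] sign_twisted_adjoint[OF tB]) simp
  then show "sign_twisted 1 ?g (A_h N \<kappa> h Alat C)" by (simp add: A_h_def)
qed

section \<open>Parity sectors\<close>

lemma Gamma_node_sign:
  "Gamma12 N = mat_diag (num_nodes N) (node_sign N alternating alternating (\<lambda>_. 1))"
  "Gamma13 N = mat_diag (num_nodes N) (node_sign N alternating (\<lambda>_. 1) alternating)"
  by (simp_all add: Gamma12_def Gamma13_def node_sign_def[abs_def] power_add)

lemma one_kron_mat_diag:
  fixes f :: "nat \<Rightarrow> 'a :: semiring_1"
  shows "1\<^sub>m p \<otimes>\<^sub>K mat_diag n f = mat_diag (p * n) (\<lambda>x. f (x mod n))"
proof (rule eq_matI)
  fix r c assume "r < dim_row (mat_diag (p * n) (\<lambda>x. f (x mod n)))"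
    "c < dim_col (mat_diag (p * n) (\<lambda>x. f (x mod n)))"
  then have rc: "r < p * n" "c < p * n" by (auto simp: mat_diag_def)
  have "r = c \<longleftrightarrow> r div n = c div n \<and> r mod n = c mod n" by (metis div_mult_mod_eq)
  then show "(1\<^sub>m p \<otimes>\<^sub>K mat_diag n f) $$ (r, c) = mat_diag (p * n) (\<lambda>x. f (x mod n)) $$ (r, c)"
    using rc div_mod_less[OF rc(1)] div_mod_less[OF rc(2)]
    by (subst kron_index[of _ p _ n]) (auto simp: mat_diag_def)
qed (auto simp: kron_def mat_diag_def)

lemma mat_diag_eigenvector_iff:
  fixes v :: "'a :: comm_semiring_1 vec"
  assumes "v \<in> carrier_vec m"
  shows "mat_diag m f *\<^sub>v v = a \<cdot>\<^sub>v v \<longleftrightarrow> (\<forall>x<m. f x * v $ x = a * v $ x)"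
proof -
  have "mat_diag m f *\<^sub>v v \<in> carrier_vec m" using assms by (intro mult_mat_vec_carrier[OF mat_diag_dim])
  moreover have "(mat_diag m f *\<^sub>v v) $ x = f x * v $ x" if "x < m" for x
    using mat_diag_mult_vec_index[OF assms that] .
  ultimately show ?thesis using assms
    by (auto simp: vec_eq_iff simp del: index_mult_mat_vec dim_mult_mat_vec)
qed

lemma sign_twisted_preserves_eigenvectors:
  assumes X: "X \<in> carrier_mat m m" "sign_twisted 1 g X" and v: "v \<in> carrier_vec m"
    and eig: "mat_diag m g *\<^sub>v v = a \<cdot>\<^sub>v v"
  shows "mat_diag m g *\<^sub>v (X *\<^sub>v v) = a \<cdot>\<^sub>v (X *\<^sub>v v)"
proof -
  have Xv: "X *\<^sub>v v \<in> carrier_vec m" using X v by simp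
  have "g r * (X *\<^sub>v v) $ r = a * (X *\<^sub>v v) $ r" if r: "r < m" for r
  proof -
    have "g r * (X $$ (r, c) * v $ c) = a * (X $$ (r, c) * v $ c)" if c: "c < m" for c
    proof (cases "X $$ (r, c) = 0")
      case False
      then have "g r = g c" using X r c unfolding sign_twisted_def by auto
      moreover have "g c * v $ c = a * v $ c" using eig c mat_diag_eigenvector_iff[OF v] by blast
      ultimately show ?thesis by (simp add: mult.left_commute)
    qed simp
    then have "(\<Sum>c = 0..<m. g r * (X $$ (r, c) * v $ c)) = (\<Sum>c = 0..<m. a * (X $$ (r, c) * v $ c))"
      by (intro sum.cong) auto
    then show ?thesis using X v r by (simp add: scalar_prod_def sum_distrib_left)
  qed
  then show ?thesis using mat_diag_eigenvector_iff[OF Xv] by blast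
qed

lemma parity_sector_invariant:
  assumes X: "X \<in> carrier_mat (3 * num_nodes N) (3 * num_nodes N)"
    and t12: "sign_twisted 1 (\<lambda>x. node_sign N alternating alternating (\<lambda>_. 1) (x mod num_nodes N)) X"
    and t13: "sign_twisted 1 (\<lambda>x. node_sign N alternating (\<lambda>_. 1) alternating (x mod num_nodes N)) X"
    and v: "v \<in> parity_sector N \<sigma>12 \<sigma>13"
  shows "X *\<^sub>v v \<in> parity_sector N \<sigma>12 \<sigma>13"
  using v sign_twisted_preserves_eigenvectors[OF X t12] sign_twisted_preserves_eigenvectors[OF X t13] X
  unfolding parity_sector_def Gamma_node_sign one_kron_mat_diag by auto

lemma parity_sector_smult:
  assumes v: "v \<in> parity_sector N \<sigma>12 \<sigma>13"
  shows "a \<cdot>\<^sub>v v \<in> parity_sector N \<sigma>12 \<sigma>13"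
  using v
  unfolding parity_sector_def Gamma_node_sign one_kron_mat_diag
  by (auto simp: mat_diag_eigenvector_iff)

section \<open>Orthonormal bases and compression\<close>

lemma orthonormal_basis_cols_range:
  assumes "orthonormal_basis_cols m Q V"
  shows "V = {Q *\<^sub>v y |y. y \<in> carrier_vec (dim_col Q)}"
proof -
  interpret vec_space "TYPE(complex)" m .
  have Q: "Q \<in> carrier_mat m (dim_col Q)" and V: "V = col_space Q"
    using assms unfolding orthonormal_basis_cols_def col_space_def by auto
  have "Q *\<^sub>v y \<in> carrier_vec (dim_row Q)" for y by (rule carrier_vecI) simp
  then show ?thesis unfolding V col_space_eq[OF Q] by auto
qed

lemma orthonormal_basis_cols_gram:
  assumes "orthonormal_basis_cols m Q V"
  shows "mat_adjoint Q * Q = 1\<^sub>m (dim_col Q)"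
proof (rule eq_matI)
  fix a b assume "a < dim_row (1\<^sub>m (dim_col Q))" "b < dim_col (1\<^sub>m (dim_col Q))"
  then have ab: "a < dim_col Q" "b < dim_col Q" by auto
  have "(mat_adjoint Q * Q) $$ (a, b) = col Q b \<bullet>c col Q a"
    using ab by (auto simp: scalar_prod_def mat_adjoint_index intro!: sum.cong)
  then show "(mat_adjoint Q * Q) $$ (a, b) = 1\<^sub>m (dim_col Q) $$ (a, b)"
    using ab assms by (auto simp: orthonormal_basis_cols_def)
qed auto

lemma adjoint_cancel:
  assumes "orthonormal_basis_cols m Q V" "y \<in> carrier_vec (dim_col Q)"
  shows "mat_adjoint Q *\<^sub>v (Q *\<^sub>v y) = y"
proof -
  have "mat_adjoint Q *\<^sub>v (Q *\<^sub>v y) = (mat_adjoint Q * Q) *\<^sub>v y"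
    using assms by (intro assoc_mult_mat_vec[symmetric]) auto
  then show ?thesis using assms by (simp add: orthonormal_basis_cols_gram)
qed

text \<open>On \<open>V\<close>, the adjoint reads off coordinates with respect to the columns of \<open>Q\<close>.\<close>

lemma adjoint_inj_on:
  assumes "orthonormal_basis_cols m Q V"
  shows "inj_on ((*\<^sub>v) (mat_adjoint Q)) V"
proof (rule inj_onI)
  fix v w assume "v \<in> V" "w \<in> V" and eq: "mat_adjoint Q *\<^sub>v v = mat_adjoint Q *\<^sub>v w"
  then obtain y z where "v = Q *\<^sub>v y" "w = Q *\<^sub>v z" "y \<in> carrier_vec (dim_col Q)"
    "z \<in> carrier_vec (dim_col Q)"
    unfolding orthonormal_basis_cols_range[OF assms] by blast
  then show "v = w" using eq adjoint_cancel[OF assms] by simp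
qed

lemma compression_mult_vec:
  assumes "Q \<in> carrier_mat m k" "X \<in> carrier_mat m m" "y \<in> carrier_vec k"
  shows "(mat_adjoint Q * X * Q) *\<^sub>v y = mat_adjoint Q *\<^sub>v (X *\<^sub>v (Q *\<^sub>v y))"
proof -
  have Q': "mat_adjoint Q \<in> carrier_mat k m" using assms by (intro carrier_matI) auto
  show ?thesis
    using assms assoc_mult_mat_vec[OF mult_carrier_mat[OF Q' assms(2)] assms(1,3)]
      assoc_mult_mat_vec[OF Q' assms(2), of "Q *\<^sub>v y"] by simp
qed

text \<open>Without invariance of \<open>V\<close> the compressed equation would only say that the residual is orthogonal
  to \<open>V\<close>; invariance puts the residual into \<open>V\<close>, so it must vanish.\<close>

lemma galerkin_equivalence:
  assumes Q: "orthonormal_basis_cols m Q V"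
    and A: "A \<in> carrier_mat m m" "\<And>v. v \<in> V \<Longrightarrow> A *\<^sub>v v \<in> V"
    and M: "M \<in> carrier_mat m m" "\<And>v. v \<in> V \<Longrightarrow> M *\<^sub>v v \<in> V"
    and smult: "\<And>v a. v \<in> V \<Longrightarrow> a \<cdot>\<^sub>v v \<in> V"
    and y: "y \<in> carrier_vec (dim_col Q)"
  shows "A *\<^sub>v (Q *\<^sub>v y) = \<omega>2 \<cdot>\<^sub>v (M *\<^sub>v (Q *\<^sub>v y)) \<longleftrightarrow>
    (mat_adjoint Q * A * Q) *\<^sub>v y = \<omega>2 \<cdot>\<^sub>v ((mat_adjoint Q * M * Q) *\<^sub>v y)"
proof -
  have Qc: "Q \<in> carrier_mat m (dim_col Q)" using Q unfolding orthonormal_basis_cols_def by auto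
  have V: "Q *\<^sub>v y \<in> V"
    unfolding orthonormal_basis_cols_range[OF Q] using y by blast
  have adj: "mat_adjoint Q *\<^sub>v (\<omega>2 \<cdot>\<^sub>v (M *\<^sub>v (Q *\<^sub>v y))) =
      \<omega>2 \<cdot>\<^sub>v (mat_adjoint Q *\<^sub>v (M *\<^sub>v (Q *\<^sub>v y)))"
  proof (rule mult_mat_vec)
    show "mat_adjoint Q \<in> carrier_mat (dim_col Q) m"
      by (rule carrier_matI) (use Q in \<open>simp_all add: orthonormal_basis_cols_def\<close>)
    show "M *\<^sub>v (Q *\<^sub>v y) \<in> carrier_vec m"
      by (rule mult_mat_vec_carrier[OF M(1) mult_mat_vec_carrier[OF Qc y]])
  qed
  show ?thesis
    using inj_on_eq_iff[OF adjoint_inj_on[OF Q] A(2)[OF V] smult[OF M(2)[OF V], of \<omega>2]]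
    unfolding compression_mult_vec[OF Qc A(1) y] compression_mult_vec[OF Qc M(1) y] adj by (rule sym)
qed

theorem corollary4p2:
  fixes N :: "nat \<Rightarrow> nat" and \<kappa> h :: "nat \<Rightarrow> real" and Alat :: "real mat"
    and C M Q :: "complex mat" and \<sigma>12 \<sigma>13 :: complex
  assumes "N 1 > 0" "N 2 > 0" "N 3 > 0"
    and "even (N 1)" "even (N 2)" "even (N 3)"
    and "h 1 > 0" "h 2 > 0" "h 3 > 0"
    and "Alat \<in> carrier_mat 3 3" "invertible_mat Alat"
    and "nodewise_local 6 (num_nodes N) C"
    and "nodewise_local 3 (num_nodes N) M"
    and "\<sigma>12 \<in> {1, - 1}" "\<sigma>13 \<in> {1, - 1}"
    and "orthonormal_basis_cols (3 * num_nodes N) Q (parity_sector N \<sigma>12 \<sigma>13)"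
  defines "A \<equiv> A_h N \<kappa> h Alat C"
    and "A\<sigma> \<equiv> mat_adjoint Q * A_h N \<kappa> h Alat C * Q"
    and "M\<sigma> \<equiv> mat_adjoint Q * M * Q"
  shows "(\<forall>(\<omega>2 :: complex). \<forall>y\<in>carrier_vec (dim_col Q).
            Q *\<^sub>v y \<in> parity_sector N \<sigma>12 \<sigma>13 \<and>
            (A *\<^sub>v (Q *\<^sub>v y) = \<omega>2 \<cdot>\<^sub>v (M *\<^sub>v (Q *\<^sub>v y)) \<longleftrightarrow> A\<sigma> *\<^sub>v y = \<omega>2 \<cdot>\<^sub>v (M\<sigma> *\<^sub>v y))) \<and>
         (\<forall>v\<in>parity_sector N \<sigma>12 \<sigma>13. \<exists>!y. y \<in> carrier_vec (dim_col Q) \<and> v = Q *\<^sub>v y)"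
proof -
  let ?V = "parity_sector N \<sigma>12 \<sigma>13" and ?n = "num_nodes N"
  note Q = \<open>orthonormal_basis_cols (3 * ?n) Q ?V\<close>
  note C = \<open>nodewise_local 6 ?n C\<close> and M = \<open>nodewise_local 3 ?n M\<close>
  note pos = \<open>N 1 > 0\<close> \<open>N 2 > 0\<close> \<open>N 3 > 0\<close>
  note U = unitary_H[of N \<kappa>, OF pos]
  note K = sign_twisted_K_mat[of N 1 \<kappa>, OF pos(1) \<open>even (N 1)\<close>]
    sign_twisted_K_mat[of N 2 \<kappa>, OF pos(2) \<open>even (N 2)\<close>]
    sign_twisted_K_mat[of N 3 \<kappa>, OF pos(3) \<open>even (N 3)\<close>]
  note K1 = sign_twisted_constant
  (* Signs of H1, H2, H3: (-, -, +) against Gamma12 and (-, +, -) against Gamma13. *)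
  have D12: "sign_preserving ?n (node_sign N alternating alternating (\<lambda>_. 1)) (D_cal N \<kappa> h Alat m)" for m
    by (rule sign_preserving_D_cal[OF U sign_twisted_H[OF pos K(1,2) K1]]) simp_all
  have D13: "sign_preserving ?n (node_sign N alternating (\<lambda>_. 1) alternating) (D_cal N \<kappa> h Alat m)" for m
    by (rule sign_preserving_D_cal[OF U sign_twisted_H[OF pos K(1) K1 K(3)]]) simp_all
  have Ac: "A \<in> carrier_mat (3 * ?n) (3 * ?n)" unfolding A_def by (rule sign_twisted_A_h[OF D12 C])
  have AV: "A *\<^sub>v v \<in> ?V" if "v \<in> ?V" for v
    using parity_sector_invariant[OF _ _ _ that] Ac sign_twisted_A_h(1)[OF D12 C]
      sign_twisted_A_h(1)[OF D13 C] unfolding A_def by blast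
  have Mc: "M \<in> carrier_mat (3 * ?n) (3 * ?n)" using M unfolding nodewise_local_def by simp
  have MV: "M *\<^sub>v v \<in> ?V" if "v \<in> ?V" for v
    using parity_sector_invariant[OF Mc _ _ that] sign_twisted_nodewise_local[OF M] by blast
  have range: "?V = {Q *\<^sub>v y |y. y \<in> carrier_vec (dim_col Q)}"
    by (rule orthonormal_basis_cols_range[OF Q])
  have "Q *\<^sub>v y \<in> ?V" if "y \<in> carrier_vec (dim_col Q)" for y
    unfolding range using that by blast
  moreover have "A *\<^sub>v (Q *\<^sub>v y) = \<omega>2 \<cdot>\<^sub>v (M *\<^sub>v (Q *\<^sub>v y)) \<longleftrightarrow> A\<sigma> *\<^sub>v y = \<omega>2 \<cdot>\<^sub>v (M\<sigma> *\<^sub>v y)"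
    if "y \<in> carrier_vec (dim_col Q)" for \<omega>2 y
    using galerkin_equivalence[OF Q Ac AV Mc MV parity_sector_smult that]
    unfolding A_def A\<sigma>_def M\<sigma>_def .
  moreover have "\<exists>!y. y \<in> carrier_vec (dim_col Q) \<and> v = Q *\<^sub>v y" if v: "v \<in> ?V" for v
  proof -
    obtain y where y: "y \<in> carrier_vec (dim_col Q)" "v = Q *\<^sub>v y" using v unfolding range by blast
    moreover have "z = y" if "z \<in> carrier_vec (dim_col Q)" "v = Q *\<^sub>v z" for z
      using adjoint_cancel[OF Q y(1)] adjoint_cancel[OF Q that(1)] that(2) y(2) by metis
    ultimately show ?thesis by blast
  qed
  ultimately show ?thesis by blast
qed

end
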